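(* Let $0<\lambda_f<\lambda_b$ and let $\xi_Q^*(z)=\left(1-\frac{\lambda_f}{\lambda_b}\right)\left(\frac{\lambda_f}{\lambda_b}\right)^z$, $z\in\mathcal{Z}$. Let $\xi\in\mathcal{M}_1(\mathcal{Z})$ be such that $\sum_{z}z\,\xi(z)<\infty$ and $\sum_z (z\log z)\,\xi(z)=\infty$. Then $I(\xi\|\xi_Q^* )<\infty$ and $V_Q(\xi)=\infty$. In particular, $V_Q\ne I(\cdot\|\xi_Q^* )$ as functions on $\mathcal{M}_1(\mathcal{Z})$.
   Context: $\mathcal{Z}=\{0,1,2,\dots\}$; $\mathcal{M}_1(\mathcal{Z})$ is the set of probability measures on $\mathcal{Z}$ with the total variation metric; $0\log0=0$. Relative entropy: $I(\zeta\|\nu)=\sum_z\zeta(z)\log(\zeta(z)/\nu(z))$ if $\zeta\ll\nu$, and $\infty$ otherwise. Let $\mathcal{E}_Q=\{(z,z+1):z\in\mathcal{Z}\}\cup\{(z,z-1):z\in\mathcal{Z}\setminus\{0\}\}$ with constant rates $\lambda_{z,z+1}=\lambda_f$ and $\lambda_{z,z-1}=\lambda_b$ (M/M/1 queue), and $L^Qf(z)=\sum_{z':(z,z')\in\mathcal{E}_Q}\lambda_{z,z'}(f(z')-f(z))$. $\xi_Q^*$ is its invariant probability measure. Let $\tau(u)=e^u-u-1$ and let $C_0^1([0,T]\times\mathcal{Z})$ be the real functions on $[0,T]\times\mathcal{Z}$ with compact support (i.e. vanishing for all $z$ outside a finite set) that are continuously differentiable in the first argument. For $\varphi\in D([0,T],\mathcal{M}_1(\mathcal{Z}))$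 (right-continuous paths with left limits) with $\varphi_0=\nu$, $$S^Q_{[0,T]}(\varphi|\nu)=\sup_{f\in C_0^1([0,T]\times\mathcal{Z})}\Big\{\langle\varphi_T,f_T\rangle-\langle\varphi_0,f_0\rangle-\int_0^T\langle\varphi_u,\partial_uf_u\rangle du-\int_0^T\langle\varphi_u,L^Qf_u\rangle du-\int_0^T\sum_{(z,z')\in\mathcal{E}_Q}\tau(f_u(z')-f_u(z))\lambda_{z,z'}\varphi_u(z)\,du\Big\},$$ where $\langle\xi,f\rangle=\sum_z\xi(z)f(z)$. The quasipotential is $$V_Q(\xi)=\inf\{S^Q_{[0,T]}(\varphi|\xi_Q^* ):\varphi(0)=\xi_Q^*,\ \varphi(T)=\xi,\ T>0\},$$ the infimum being over all $T>0$ and $\varphi\in D([0,T],\mathcal{M}_1(\mathcal{Z}))$ (with $\inf\emptyset=\infty$). *)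

theory Defs
  imports "HOL-Probability.Probability"
begin

text \<open>
  The state space is \<open>nat\<close>, and probability measures on it are elements of \<^typ>\<open>nat pmf\<close>.
  Paths on \<open>[0,T]\<close> are functions on all of \<open>real\<close>; every notion below only looks at their
  restriction to \<open>{0..T}\<close>.
\<close>

definition tv_dist :: "nat pmf \<Rightarrow> nat pmf \<Rightarrow> real" where
  "tv_dist \<mu> \<nu> = (SUP A. \<bar>measure_pmf.prob \<mu> A - measure_pmf.prob \<nu> A\<bar>)"

definition cadlag :: "real \<Rightarrow> (real \<Rightarrow> nat pmf) \<Rightarrow> bool" where
  "cadlag T \<phi> \<longleftrightarrow>
     (\<forall>t\<in>{0..<T}. ((\<lambda>s. tv_dist (\<phi> s) (\<phi> t)) \<longlongrightarrow> 0) (at_right t)) \<and>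
     (\<forall>t\<in>{0<..T}. \<exists>\<mu>. ((\<lambda>s. tv_dist (\<phi> s) \<mu>) \<longlongrightarrow> 0) (at_left t))"

text \<open>
  A series of reals as an extended real: sum of the positive parts minus sum of the negative parts
  (\<^const>\<open>ennreal\<close> maps negative numbers to \<open>0\<close>).
\<close>

definition ext_sum :: "(nat \<Rightarrow> real) \<Rightarrow> ereal" where
  "ext_sum g = enn2ereal (\<Sum>z. ennreal (g z)) - enn2ereal (\<Sum>z. ennreal (- g z))"

text \<open>
  Since \<open>\<zeta>(z) ln (\<zeta>(z) / \<nu>(z)) \<ge> - exp (- 1) \<nu>(z)\<close>, the negative parts in the relative entropy sum to
  at most \<open>exp (- 1)\<close>, and the difference in \<^const>\<open>ext_sum\<close> is never \<open>\<infinity> - \<infinity>\<close>.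
\<close>

definition rel_entropy :: "nat pmf \<Rightarrow> nat pmf \<Rightarrow> ereal" where
  "rel_entropy \<zeta> \<nu> =
     (if absolutely_continuous (measure_pmf \<nu>) (measure_pmf \<zeta>)
      then ext_sum (\<lambda>z. pmf \<zeta> z * ln (pmf \<zeta> z / pmf \<nu> z))
      else \<infinity>)"

definition E_Q :: "(nat \<times> nat) set" where
  "E_Q = {(z, z + 1) | z. True} \<union> {(z, z - 1) | z. z \<noteq> 0}"

definition rate_Q :: "real \<Rightarrow> real \<Rightarrow> nat \<Rightarrow> nat \<Rightarrow> real" where
  "rate_Q lam_f lam_b z z' = (if z' = z + 1 then lam_f else if z = z' + 1 then lam_b else 0)"

definition L_Q :: "real \<Rightarrow> real \<Rightarrow> (nat \<Rightarrow> real) \<Rightarrow> nat \<Rightarrow> real" where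
  "L_Q lam_f lam_b f z = (\<Sum>z' | (z, z') \<in> E_Q. rate_Q lam_f lam_b z z' * (f z' - f z))"

definition tau :: "real \<Rightarrow> real" where
  "tau u = exp u - u - 1"

definition pairing :: "nat pmf \<Rightarrow> (nat \<Rightarrow> real) \<Rightarrow> real" where
  "pairing \<xi> f = (\<Sum>\<^sub>\<infinity>z. pmf \<xi> z * f z)"

definition dt :: "real \<Rightarrow> (real \<Rightarrow> nat \<Rightarrow> real) \<Rightarrow> real \<Rightarrow> nat \<Rightarrow> real" where
  "dt T f u z = vector_derivative (\<lambda>s. f s z) (at u within {0..T})"

definition C01 :: "real \<Rightarrow> (real \<Rightarrow> nat \<Rightarrow> real) set" where
  "C01 T = {f. finite {z. \<exists>t\<in>{0..T}. f t z \<noteq> 0} \<and>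
              (\<forall>z. (\<lambda>t. f t z) differentiable_on {0..T} \<and>
                   continuous_on {0..T} (\<lambda>t. dt T f t z))}"

text \<open>
  For \<open>T > 0\<close>, \<open>f \<in> C01 T\<close> and \<open>cadlag T \<phi>\<close> all sums below have finitely many nonzero terms and all
  integrands are bounded and measurable, so no default value of a sum or integral is involved.
  \<open>S_Q\<close> is only ever used with \<open>\<phi> 0 = \<nu>\<close>; the other case is a totalisation.
\<close>

definition S_Q :: "real \<Rightarrow> real \<Rightarrow> real \<Rightarrow> (real \<Rightarrow> nat pmf) \<Rightarrow> nat pmf \<Rightarrow> ereal" where
  "S_Q lam_f lam_b T \<phi> \<nu> =
     (if \<phi> 0 = \<nu> then
        (SUP f\<in>C01 T. ereal (
            pairing (\<phi> T) (f T) - pairing (\<phi> 0) (f 0)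
          - (LBINT u:{0..T}. pairing (\<phi> u) (dt T f u))
          - (LBINT u:{0..T}. pairing (\<phi> u) (L_Q lam_f lam_b (f u)))
          - (LBINT u:{0..T}. \<Sum>\<^sub>\<infinity>(z, z')\<in>E_Q.
                tau (f u z' - f u z) * rate_Q lam_f lam_b z z' * pmf (\<phi> u) z)))
      else \<infinity>)"

text \<open>
  The quasipotential relative to the starting measure \<open>\<xi>Q\<close>, which is meant to be the invariant
  measure of the queue. In \<^typ>\<open>ereal\<close> the infimum of the empty set is \<open>\<infinity>\<close>.
\<close>

definition V_Q :: "real \<Rightarrow> real \<Rightarrow> nat pmf \<Rightarrow> nat pmf \<Rightarrow> ereal" where
  "V_Q lam_f lam_b \<xi>Q \<xi> =
     Inf {S_Q lam_f lam_b T \<phi> \<xi>Q | T \<phi>. T > 0 \<and> cadlag T \<phi> \<and> \<phi> 0 = \<xi>Q \<and> \<phi> T = \<xi>}"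

end

(*
  The variational formula for S_Q is tested with f_u(z) = A(z) + (T - u) B(z), where A(z) = ln(z!) / 2
  and B(z) = z up to a level N. Then exp (f_u(z+1) - f_u(z)) = exp (T - u) * sqrt (z + 1) is
  sublinear in z, so the jump terms are absorbed by the time derivative -B(z) = -z up to a constant
  independent of N. Beyond N both A and B descend to 0 with slope -1, which keeps the contribution
  of the downward jumps bounded. If S_Q is finite, letting N tend to infinity bounds the mean of
  ln(z!), which is of order z ln z, under the endpoint of the path.
  For the last claim take mass proportional to 1 / (2^k (k+1)^2) at the point 2^k.
*)
theory Submission
  imports Defs
begin

section \<open>Measurability and integrability along cadlag paths\<close>

lemma pmf_diff_le_tv_dist: "\<bar>pmf \<mu> z - pmf \<nu> z\<bar> \<le> tv_dist \<mu> \<nu>"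
proof -
  have "bdd_above (range (\<lambda>A. \<bar>measure_pmf.prob \<mu> A - measure_pmf.prob \<nu> A\<bar>))"
  proof (rule bdd_aboveI2)
    fix A
    show "\<bar>measure_pmf.prob \<mu> A - measure_pmf.prob \<nu> A\<bar> \<le> 1"
      using measure_pmf.prob_le_1[of \<mu> A] measure_pmf.prob_le_1[of \<nu> A]
        measure_nonneg[of \<mu> A] measure_nonneg[of \<nu> A] by linarith
  qed
  from cSUP_upper[OF _ this, of "{z}"] show ?thesis
    by (simp add: tv_dist_def pmf.rep_eq)
qed

text \<open>Sampling \<open>g\<close> at the next grid point to the right of \<open>t\<close> gives
  measurable functions, which converge pointwise to \<open>g\<close> by right-continuity.\<close>

lemma borel_measurable_right_continuous:
  fixes g :: "real \<Rightarrow> real"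
  assumes "\<And>t. a \<le> t \<Longrightarrow> t < b \<Longrightarrow> (g \<longlongrightarrow> g t) (at_right t)"
  shows "(\<lambda>t. indicator {a..b} t * g t) \<in> borel_measurable borel"
proof -
  \<comment> \<open>Floor plus one, not the ceiling, makes the grid point strictly larger than
    \<open>t\<close>, as \<open>at_right\<close> demands. The cap gives \<open>r n b = b\<close>, so
    nothing is asked of \<open>g\<close> to the right of \<open>b\<close>.\<close>
  define r where "r n t = min b ((of_int \<lfloor>real (Suc n) * t\<rfloor> + 1) / real (Suc n))" for n t
  have meas: "(\<lambda>t. indicator {a..b} t * g (r n t)) \<in> borel_measurable borel" for n
  proof -
    have "(\<lambda>k::int. g (min b ((of_int k + 1) / real (Suc n)))) \<in> measurable (count_space UNIV) borel"
      by simp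
    from measurable_compose[OF _ this, of "\<lambda>t. \<lfloor>real (Suc n) * t\<rfloor>" borel]
    have "(\<lambda>t. g (r n t)) \<in> borel_measurable borel"
      unfolding r_def by measurable
    then show ?thesis by measurable
  qed
  have gt: "t < (of_int \<lfloor>real (Suc n) * t\<rfloor> + 1) / real (Suc n)" for n t
    by (simp add: field_simps del: of_nat_Suc) linarith
  have le: "(of_int \<lfloor>real (Suc n) * t\<rfloor> + 1) / real (Suc n) \<le> t + 1 / real (Suc n)" for n t
    by (simp add: field_simps del: of_nat_Suc)
  show ?thesis
  proof (rule borel_measurable_LIMSEQ_real[OF _ meas])
    fix t :: real
    consider "t \<notin> {a..b}" | "t = b" | "a \<le> t" "t < b" by force
    then show "(\<lambda>n. indicator {a..b} t * g (r n t)) \<longlonglongrightarrow> indicator {a..b} t * g t"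
    proof cases
      case 2
      then have "r n t = b" for n using gt[of t n] by (simp add: r_def)
      with 2 show ?thesis by simp
    next
      case 3
      have tr: "t < r n t" for n using gt[of t n] 3 by (simp add: r_def)
      have "(\<lambda>n. r n t) \<longlonglongrightarrow> t"
      proof (rule tendsto_sandwich)
        show "\<forall>\<^sub>F n in sequentially. t \<le> r n t"
          using tr by (simp add: less_imp_le)
        show "\<forall>\<^sub>F n in sequentially. r n t \<le> t + 1 / real (Suc n)"
          using le by (intro always_eventually) (auto simp: r_def min.coboundedI2)
        show "(\<lambda>n. t + 1 / real (Suc n)) \<longlonglongrightarrow> t"
          using tendsto_add[OF tendsto_const lim_1_over_n[THEN LIMSEQ_Suc]] by (simp add: o_def)
      qed simp
      moreover have "\<forall>\<^sub>F n in sequentially. r n t \<in> {t<..} \<and> r n t \<noteq> t"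
        using tr by (simp add: less_imp_neq[THEN not_sym])
      ultimately have "filterlim (\<lambda>n. r n t) (at_right t) sequentially"
        by (simp add: filterlim_at)
      from filterlim_compose[OF assms[OF 3] this] show ?thesis
        using 3 by simp
    qed simp
  qed
qed

text \<open>Total variation dominates the change of each point mass, so every coordinate of the path
  is right-continuous.\<close>

lemma cadlag_pmf_measurable:
  assumes "cadlag T \<phi>"
  shows "(\<lambda>t. indicator {0..T} t * pmf (\<phi> t) z) \<in> borel_measurable borel"
proof (rule borel_measurable_right_continuous)
  fix t :: real assume "0 \<le> t" "t < T"
  with assms have "((\<lambda>s. tv_dist (\<phi> s) (\<phi> t)) \<longlongrightarrow> 0) (at_right t)"
    by (auto simp: cadlag_def)
  then have "((\<lambda>s. pmf (\<phi> s) z - pmf (\<phi> t) z) \<longlongrightarrow> 0) (at_right t)"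
    by (rule Lim_null_comparison[rotated]) (simp add: pmf_diff_le_tv_dist)
  then show "((\<lambda>s. pmf (\<phi> s) z) \<longlongrightarrow> pmf (\<phi> t) z) (at_right t)"
    by (simp add: LIM_zero_iff)
qed

lemma cadlag_set_integrable:
  assumes "cadlag T \<phi>" and "finite F" and c: "\<And>z. z \<in> F \<Longrightarrow> continuous_on {0..T} (\<lambda>u. c u z)"
  shows "set_integrable lborel {0..T} (\<lambda>u. \<Sum>z\<in>F. pmf (\<phi> u) z * c u z)"
  using \<open>finite F\<close> c
proof (induction F)
  case empty
  show ?case by (simp add: set_integrable_def)
next
  case (insert z F)
  then have i: "set_integrable lborel {0..T} (\<lambda>u. c u z)"
    by (intro borel_integrable_atLeastAtMost') simp
  then have m: "(\<lambda>u. indicator {0..T} u * c u z) \<in> borel_measurable borel"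
    unfolding set_integrable_def by (auto dest!: borel_measurable_integrable)
  \<comment> \<open>Both factors carry the indicator because each is known to be measurable only
    after restriction to \<open>{0..T}\<close>. Integrability then follows from that of
    \<open>c\<close>, since point masses are at most 1.\<close>
  have "(\<lambda>u. (indicator {0..T} u * pmf (\<phi> u) z) * (indicator {0..T} u * c u z)) \<in> borel_measurable borel"
    by (rule borel_measurable_times[OF cadlag_pmf_measurable[OF assms(1)] m])
  also have "(\<lambda>u. (indicator {0..T} u * pmf (\<phi> u) z) * (indicator {0..T} u * c u z)) =
      (\<lambda>u. indicator {0..T} u *\<^sub>R (pmf (\<phi> u) z * c u z))"
    by (auto simp: indicator_def)
  finally have "set_integrable lborel {0..T} (\<lambda>u. pmf (\<phi> u) z * c u z)"
    by (intro set_integrable_bound[OF i])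
      (auto simp: set_borel_measurable_def abs_mult pmf_le_1 mult_left_le_one_le)
  with insert show ?case by simp
qed

section \<open>Reduction of the action functional to finite sums\<close>

lemma pairing_eq_sum:
  assumes "finite F" and "\<And>z. z \<notin> F \<Longrightarrow> g z = 0"
  shows "pairing \<mu> g = (\<Sum>z\<in>F. pmf \<mu> z * g z)"
proof -
  have "pairing \<mu> g = (\<Sum>\<^sub>\<infinity>z\<in>F. pmf \<mu> z * g z)"
    unfolding pairing_def by (rule infsum_cong_neutral) (auto simp: assms)
  with assms show ?thesis by simp
qed

text \<open>An average over a set whose mass may be less than 1, hence the requirement that
  \<open>D\<close> be nonnegative.\<close>

lemma sum_pmf_mult_le:
  assumes "finite F" and "\<And>z. z \<in> F \<Longrightarrow> g z \<le> D" and "0 \<le> D"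
  shows "(\<Sum>z\<in>F. pmf \<mu> z * g z) \<le> D"
proof -
  have "(\<Sum>z\<in>F. pmf \<mu> z * g z) \<le> (\<Sum>z\<in>F. pmf \<mu> z * D)"
    by (intro sum_mono mult_left_mono assms) auto
  also have "\<dots> = measure_pmf.prob \<mu> F * D"
    using assms by (simp add: measure_measure_pmf_finite sum_distrib_right)
  also have "\<dots> \<le> 1 * D"
    by (intro mult_right_mono assms) auto
  finally show ?thesis by simp
qed

text \<open>
  The jump terms of \<^const>\<open>S_Q\<close> combine, since \<open>x + tau x = exp x - 1\<close>; the result is
  \<open>exp (- f)\<close> times the generator applied to \<open>exp f\<close>.
\<close>

definition exp_gen :: "real \<Rightarrow> real \<Rightarrow> (nat \<Rightarrow> real) \<Rightarrow> nat \<Rightarrow> real" where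
  "exp_gen lam_f lam_b f z =
     lam_f * (exp (f (Suc z) - f z) - 1) + (if z = 0 then 0 else lam_b * (exp (f (z - 1) - f z) - 1))"

lemma E_Q_section: "{z'. (z, z') \<in> E_Q} = {Suc z} \<union> (if z = 0 then {} else {z - 1})"
  by (auto simp: E_Q_def)

lemma sum_E_Q_section:
  "(\<Sum>z' | (z, z') \<in> E_Q. rate_Q lam_f lam_b z z' * h z') =
     lam_f * h (Suc z) + (if z = 0 then 0 else lam_b * h (z - 1))"
  unfolding E_Q_section by (cases z) (auto simp: rate_Q_def)

lemma L_Q_eq:
  "L_Q lam_f lam_b f z =
     lam_f * (f (Suc z) - f z) + (if z = 0 then 0 else lam_b * (f (z - 1) - f z))"
  unfolding L_Q_def by (rule sum_E_Q_section)

text \<open>An edge leaving a point above \<open>K\<close> ends at \<open>K\<close> or higher, so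
  \<open>f\<close> vanishes at both ends and \<open>tau 0 = 0\<close>. The point \<open>K\<close>
  itself must stay in the sum: its downward edge can reach a nonzero value of
  \<open>f\<close>.\<close>

lemma infsum_E_Q:
  assumes f: "\<And>z. K \<le> z \<Longrightarrow> f z = 0"
  shows "(\<Sum>\<^sub>\<infinity>(z, z')\<in>E_Q. tau (f z' - f z) * rate_Q lam_f lam_b z z' * p z) =
    (\<Sum>z\<le>K. p z * (lam_f * tau (f (Suc z) - f z) +
       (if z = 0 then 0 else lam_b * tau (f (z - 1) - f z))))"
proof -
  define h where "h = (\<lambda>(z, z'). tau (f z' - f z) * rate_Q lam_f lam_b z z' * p z)"
  define S where "S = Sigma {..K} (\<lambda>z. {z'. (z, z') \<in> E_Q})"
  have fin: "finite {z'. (z, z') \<in> E_Q}" for z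
    by (auto simp: E_Q_section)
  then have "finite S" by (auto simp: S_def)
  have "infsum h E_Q = infsum h S"
  proof (rule infsum_cong_neutral)
    fix x assume "x \<in> E_Q - S"
    then obtain z z' where x: "x = (z, z')" "(z, z') \<in> E_Q" "\<not> z \<le> K"
      by (cases x) (auto simp: S_def)
    then have "K \<le> z'" by (auto simp: E_Q_def)
    with x show "h x = 0" by (simp add: h_def f tau_def)
  qed (auto simp: S_def)
  also have "\<dots> = sum h S" using \<open>finite S\<close> by simp
  also have "\<dots> = (\<Sum>z\<le>K. \<Sum>z' | (z, z') \<in> E_Q. h (z, z'))"
    unfolding S_def using fin by (subst sum.Sigma) auto
  also have "\<dots> = (\<Sum>z\<le>K. p z * (\<Sum>z' | (z, z') \<in> E_Q. rate_Q lam_f lam_b z z' * tau (f z' - f z)))"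
    by (simp add: h_def sum_distrib_left mult_ac)
  finally show ?thesis
    by (simp add: h_def sum_E_Q_section)
qed


lemma continuous_on_if_const:
  "\<lbrakk>P \<Longrightarrow> continuous_on S f; \<not> P \<Longrightarrow> continuous_on S g\<rbrakk> \<Longrightarrow>
    continuous_on S (\<lambda>x. if P then f x else g x)"
  by (cases P) simp_all

text \<open>The test function \<open>A + (T - u) B\<close> equals \<open>A\<close> at time
  \<open>T\<close>, \<open>A + T B\<close> at time 0, and has time derivative \<open>- B\<close>.
  The three subtracted integrals therefore combine into the integral of the mean of
  \<open>exp_gen - B\<close>, which is at most \<open>T * D\<close>.\<close>

lemma S_Q_ge_affine_test:
  assumes "0 < T" and cad: "cadlag T \<phi>"
    and A: "\<And>z. K \<le> z \<Longrightarrow> A z = 0" and B: "\<And>z. K \<le> z \<Longrightarrow> B z = 0"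
    and bound: "\<And>u z. \<lbrakk>0 \<le> u; u \<le> T\<rbrakk> \<Longrightarrow>
      exp_gen lam_f lam_b (\<lambda>z. A z + (T - u) * B z) z - B z \<le> D"
    and "0 \<le> D"
  shows "ereal (pairing (\<phi> T) A - pairing (\<phi> 0) (\<lambda>z. A z + T * B z) - T * D)
    \<le> S_Q lam_f lam_b T \<phi> (\<phi> 0)"
proof -
  define f where "f u z = A z + (T - u) * B z" for u z
  define p where "p u z = pmf (\<phi> u) z" for u z
  define tt where "tt u z = lam_f * tau (f u (Suc z) - f u z) +
      (if z = 0 then 0 else lam_b * tau (f u (z - 1) - f u z))" for u z
  have f0: "f u z = 0" if "K \<le> z" for u z using A B that by (simp add: f_def)
  have deriv: "((\<lambda>u. f u z) has_vector_derivative - B z) (at u)" for u z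
    unfolding f_def by (auto intro!: derivative_eq_intros)
  \<comment> \<open>At the end points the derivative is one-sided; \<open>0 < T\<close> makes it
    unique there.\<close>
  have dt: "dt T f u z = - B z" if "u \<in> {0..T}" for u z
    unfolding dt_def using deriv that \<open>0 < T\<close> by (intro vector_derivative_at_within_ivl) auto
  have "f \<in> C01 T"
    unfolding C01_def
  proof (intro CollectI conjI allI)
    show "finite {z. \<exists>t\<in>{0..T}. f t z \<noteq> 0}"
      by (rule finite_subset[of _ "{..K}"]) (auto intro: ccontr simp: f0)
    show "(\<lambda>t. f t z) differentiable_on {0..T}" for z
      using deriv by (intro differentiable_at_imp_differentiable_on differentiableI_vector) auto
    have "continuous_on {0..T} (\<lambda>t. - B z)" for z by simp
    then show "continuous_on {0..T} (\<lambda>t. dt T f t z)" for z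
      by (rule continuous_on_eq) (simp add: dt)
  qed
  have 1: "(LBINT u:{0..T}. pairing (\<phi> u) (dt T f u)) = (LBINT u:{0..T}. \<Sum>z\<le>K. p u z * - B z)"
  proof (rule set_lebesgue_integral_cong)
    show "\<forall>u. u \<in> {0..T} \<longrightarrow> pairing (\<phi> u) (dt T f u) = (\<Sum>z\<le>K. p u z * - B z)"
    proof safe
      fix u assume u: "u \<in> {0..T}"
      then have "pairing (\<phi> u) (dt T f u) = (\<Sum>z\<le>K. p u z * dt T f u z)"
        unfolding p_def by (intro pairing_eq_sum) (auto simp: dt B)
      then show "pairing (\<phi> u) (dt T f u) = (\<Sum>z\<le>K. p u z * - B z)"
        using u by (simp add: dt)
    qed
  qed simp
  have 2: "(LBINT u:{0..T}. pairing (\<phi> u) (L_Q lam_f lam_b (f u))) =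
      (LBINT u:{0..T}. \<Sum>z\<le>K. p u z * L_Q lam_f lam_b (f u) z)"
    unfolding p_def by (subst pairing_eq_sum[of "{..K}"]) (auto simp: L_Q_eq f0)
  have 3: "(LBINT u:{0..T}. \<Sum>\<^sub>\<infinity>(z, z')\<in>E_Q. tau (f u z' - f u z) * rate_Q lam_f lam_b z z' * pmf (\<phi> u) z) =
      (LBINT u:{0..T}. \<Sum>z\<le>K. p u z * tt u z)"
    unfolding p_def tt_def by (subst infsum_E_Q[of K]) (auto simp: f0)
  have i1: "set_integrable lborel {0..T} (\<lambda>u. \<Sum>z\<le>K. p u z * - B z)"
    unfolding p_def by (rule cadlag_set_integrable[OF cad]) auto
  have i2: "set_integrable lborel {0..T} (\<lambda>u. \<Sum>z\<le>K. p u z * L_Q lam_f lam_b (f u) z)"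
    unfolding p_def by (rule cadlag_set_integrable[OF cad])
      (auto simp: L_Q_eq f_def intro!: continuous_intros continuous_on_if_const)
  have i3: "set_integrable lborel {0..T} (\<lambda>u. \<Sum>z\<le>K. p u z * tt u z)"
    unfolding p_def by (rule cadlag_set_integrable[OF cad])
      (auto simp: tt_def tau_def f_def intro!: continuous_intros continuous_on_if_const)
  have "(\<Sum>z\<le>K. p u z * - B z) + (\<Sum>z\<le>K. p u z * L_Q lam_f lam_b (f u) z) + (\<Sum>z\<le>K. p u z * tt u z)
      = (\<Sum>z\<le>K. p u z * (exp_gen lam_f lam_b (f u) z - B z))" for u
    unfolding sum.distrib[symmetric]
    by (intro sum.cong refl) (simp add: L_Q_eq exp_gen_def tau_def tt_def algebra_simps)
  moreover have "(\<Sum>z\<le>K. p u z * (exp_gen lam_f lam_b (f u) z - B z)) \<le> D" if "u \<in> {0..T}" for u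
    unfolding p_def using that \<open>0 \<le> D\<close> by (intro sum_pmf_mult_le) (auto simp: f_def[abs_def] intro!: bound)
  ultimately have "(LBINT u:{0..T}. (\<Sum>z\<le>K. p u z * - B z) + (\<Sum>z\<le>K. p u z * L_Q lam_f lam_b (f u) z)
      + (\<Sum>z\<le>K. p u z * tt u z)) \<le> (LBINT u:{0..T}. D)"
    by (intro set_integral_mono set_integral_add i1 i2 i3 borel_integrable_atLeastAtMost') simp_all
  also have "\<dots> = T * D"
    using \<open>0 < T\<close> by (simp add: set_integral_const)
  finally have le: "(LBINT u:{0..T}. \<Sum>z\<le>K. p u z * - B z)
      + (LBINT u:{0..T}. \<Sum>z\<le>K. p u z * L_Q lam_f lam_b (f u) z)
      + (LBINT u:{0..T}. \<Sum>z\<le>K. p u z * tt u z) \<le> T * D"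
    using i1 i2 i3 by (simp only: set_integral_add)
  have fT: "f T = A" "f 0 = (\<lambda>z. A z + T * B z)"
    by (auto simp: f_def)
  have "ereal (pairing (\<phi> T) A - pairing (\<phi> 0) (\<lambda>z. A z + T * B z) - T * D) \<le>
      ereal (pairing (\<phi> T) (f T) - pairing (\<phi> 0) (f 0)
          - (LBINT u:{0..T}. pairing (\<phi> u) (dt T f u))
          - (LBINT u:{0..T}. pairing (\<phi> u) (L_Q lam_f lam_b (f u)))
          - (LBINT u:{0..T}. \<Sum>\<^sub>\<infinity>(z, z')\<in>E_Q.
                tau (f u z' - f u z) * rate_Q lam_f lam_b z z' * pmf (\<phi> u) z))"
    using le unfolding 1 2 3 fT by simp
  also have "\<dots> \<le> S_Q lam_f lam_b T \<phi> (\<phi> 0)"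
    unfolding S_Q_def using \<open>f \<in> C01 T\<close> by (simp only: if_True simp_thms) (rule SUP_upper)
  finally show ?thesis .
qed

section \<open>Truncated test functions and a generator bound uniform in the level\<close>

text \<open>An abrupt cut to 0 after \<open>N\<close> would also give finite support, but the
  downward jump from \<open>N + 1\<close> would then contribute a term of size
  \<open>exp (a N)\<close>.\<close>

definition trunc :: "nat \<Rightarrow> (nat \<Rightarrow> real) \<Rightarrow> nat \<Rightarrow> real" where
  "trunc N a z = (if z \<le> N then a z else max 0 (a N - real (z - N)))"

lemma trunc_nonneg: "(\<And>z. 0 \<le> a z) \<Longrightarrow> 0 \<le> trunc N a z"
  by (simp add: trunc_def)

lemma trunc_le: "\<lbrakk>mono a; \<And>z. 0 \<le> a z\<rbrakk> \<Longrightarrow> trunc N a z \<le> a z"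
  using monoD[of a N z] by (auto simp: trunc_def intro: order_trans[of _ "a N"])

lemma trunc_eq_0: "\<lbrakk>0 \<le> a N; N + nat \<lceil>a N\<rceil> \<le> z\<rbrakk> \<Longrightarrow> trunc N a z = 0"
proof -
  assume *: "0 \<le> a N" "N + nat \<lceil>a N\<rceil> \<le> z"
  then have "a N \<le> real (z - N)" "N \<le> z"
    using real_nat_ceiling_ge[of "a N"] by linarith+
  with * show ?thesis by (cases "z = N") (auto simp: trunc_def)
qed

lemma trunc_Suc_le: "\<lbrakk>0 \<le> a N; N \<le> z\<rbrakk> \<Longrightarrow> trunc N a (Suc z) \<le> trunc N a z"
  by (auto simp: trunc_def max_def of_nat_diff)

lemma trunc_drop_le: "\<lbrakk>mono a; \<And>z. 0 \<le> a z\<rbrakk> \<Longrightarrow> trunc N a z - trunc N a (Suc z) \<le> (if z < N then 0 else 1)"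
  using monoD[of a z "Suc z"] by (auto simp: trunc_def max_def of_nat_diff)

lemma ln_fact_Suc: "ln (fact (Suc n)) = ln (real (Suc n)) + ln (fact n)"
  by (simp only: fact_Suc of_nat_mult of_nat_fact) (simp add: ln_mult)

lemma ln_fact_nonneg: "0 \<le> ln (fact n :: real)"
  by (simp add: ln_ge_zero)

lemma mono_ln_fact: "mono (\<lambda>n. ln (fact n :: real))"
  by (intro monoI) (simp add: fact_mono)

text \<open>Downward jumps can contribute a positive amount only above \<open>N\<close>, upward
  jumps only below \<open>N\<close>. The factor 1/2 in \<open>a\<close> makes the upward term grow
  like \<open>sqrt (z + 1)\<close>, so that subtracting \<open>z\<close> compensates it. The
  resulting bound does not involve \<open>N\<close>.\<close>

lemma exp_gen_trunc_le:
  fixes a :: "nat \<Rightarrow> real"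
  defines "a \<equiv> \<lambda>z. ln (fact z) / 2"
  assumes "0 < lam_f" "0 < lam_b" "0 \<le> t" "t \<le> T"
  shows "exp_gen lam_f lam_b (\<lambda>z. trunc N a z + t * trunc N real z) z - trunc N real z
    \<le> lam_b * (exp (1 + T) - 1) + 1 + (lam_f * exp T)\<^sup>2"
proof -
  define f where "f z = trunc N a z + t * trunc N real z" for z
  have a: "mono a" "\<And>z. 0 \<le> a z" and r: "mono real"
    using mono_ln_fact by (auto simp: a_def mono_def ln_fact_nonneg divide_right_mono)
  \<comment> \<open>Up to \<open>N\<close> the function \<open>f\<close> is nondecreasing; beyond
    \<open>N\<close> one step down raises it by at most \<open>1 + t\<close>.\<close>
  have down: "(if z = 0 then 0 else lam_b * (exp (f (z - 1) - f z) - 1)) \<le>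
      (if z \<le> N then 0 else lam_b * (exp (1 + T) - 1))"
  proof (cases z)
    case (Suc y)
    \<comment> \<open>Bounds the drop from \<open>y\<close> to \<open>z = y + 1\<close>; the
      condition \<open>y < N\<close> is \<open>z \<le> N\<close>.\<close>
    define d where "d = (if y < N then 0 else 1::real)"
    have "t * (trunc N real y - trunc N real (Suc y)) \<le> t * d"
      unfolding d_def using \<open>0 \<le> t\<close> by (intro mult_left_mono trunc_drop_le r) auto
    moreover have "trunc N a y - trunc N a (Suc y) \<le> d"
      unfolding d_def by (rule trunc_drop_le[OF a])
    moreover have "t * d \<le> T * d" using \<open>t \<le> T\<close> by (simp add: d_def)
    ultimately have "f y - f (Suc y) \<le> (1 + T) * d"
      by (simp add: f_def algebra_simps)
    then show ?thesis
      using \<open>0 < lam_b\<close> by (auto simp: Suc d_def mult_le_0_iff split: if_splits)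
  qed (use assms in auto)
  have rn: "0 \<le> trunc N real z" by (rule trunc_nonneg) simp
  \<comment> \<open>From \<open>N\<close> on both truncations are nonincreasing, so only
    \<open>z < N\<close> needs the compensating term.\<close>
  have up: "lam_f * (exp (f (Suc z) - f z) - 1) - trunc N real z \<le> (if z < N then 1 + (lam_f * exp T)\<^sup>2 else 0)"
  proof (cases "z < N")
    case True
    define s where "s = sqrt (real (Suc z))"
    have "f (Suc z) - f z = ln (real (Suc z)) / 2 + t"
      using True by (simp add: f_def trunc_def a_def ln_fact_Suc field_simps del: fact_Suc)
    then have "exp (f (Suc z) - f z) = s * exp t"
      by (simp add: s_def exp_add ln_sqrt[symmetric])
    also have "\<dots> \<le> s * exp T" using \<open>t \<le> T\<close> by (simp add: s_def)
    finally have "lam_f * (exp (f (Suc z) - f z) - 1) \<le> lam_f * (s * exp T - 1)"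
      using \<open>0 < lam_f\<close> by simp
    also have "\<dots> \<le> s * (lam_f * exp T)"
      using \<open>0 < lam_f\<close> by (simp add: algebra_simps)
    \<comment> \<open>The inequality \<open>2 x y \<le> x^2 + y^2\<close> turns \<open>s\<close>
      into its square \<open>z + 1\<close>, whose growth equals that of
      \<open>trunc N real z\<close>.\<close>
    also have "\<dots> \<le> s\<^sup>2 + (lam_f * exp T)\<^sup>2"
    proof -
      have "0 \<le> s * (lam_f * exp T)" using \<open>0 < lam_f\<close> by (simp add: s_def)
      with sum_squares_bound[of s "lam_f * exp T"] show ?thesis by linarith
    qed
    also have "s\<^sup>2 = real z + 1" by (simp add: s_def)
    finally show ?thesis using True by (simp add: trunc_def)
  next
    case False
    have "f (Suc z) - f z \<le> 0"
      using trunc_Suc_le[of a N z] trunc_Suc_le[of real N z] a False \<open>0 \<le> t\<close>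
      by (simp add: f_def add_mono mult_left_mono)
    then have "lam_f * (exp (f (Suc z) - f z) - 1) \<le> 0"
      using \<open>0 < lam_f\<close> by (simp add: mult_le_0_iff)
    then show ?thesis using False rn by simp
  qed
  have "0 \<le> lam_b * (exp (1 + T) - 1)" using assms by simp
  moreover have "0 \<le> (lam_f * exp T)\<^sup>2" by simp
  moreover have "exp_gen lam_f lam_b f z - trunc N real z \<le>
      (if z \<le> N then 0 else lam_b * (exp (1 + T) - 1)) + (if z < N then 1 + (lam_f * exp T)\<^sup>2 else 0)"
    using up down unfolding exp_gen_def by linarith
  ultimately show ?thesis
    unfolding f_def[symmetric] by (simp split: if_splits; linarith)
qed


section \<open>Finite action controls the mean of ln(z!) at the end point\<close>

text \<open>A weak form of Stirling's formula. Passing from \<open>n\<close> to \<open>n + 1\<close>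
  costs \<open>n (ln (n + 1) - ln n)\<close>, which is at most 1.\<close>

lemma mult_ln_le_ln_fact: "real n * ln (real n) \<le> ln (fact n) + real n"
proof (induction n)
  case (Suc n)
  have "real n * (ln (real (Suc n)) - ln (real n)) \<le> 1"
  proof (cases "n = 0")
    case False
    have "ln (real (Suc n)) - ln (real n) = ln (1 + 1 / real n)"
      using False ln_divide_pos[of "real (Suc n)" "real n"] by (simp add: field_simps)
    also have "\<dots> \<le> 1 / real n" by (rule ln_add_one_self_le_self) simp
    finally show ?thesis using False by (simp add: field_simps)
  qed simp
  then show ?case using Suc unfolding ln_fact_Suc by (simp add: algebra_simps)
qed simp

text \<open>A crude bound that lets a second moment of the initial measure control its mean of
  \<open>ln (fact z)\<close>.\<close>

lemma ln_fact_le_square: "ln (fact n) \<le> (real n)\<^sup>2"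
proof (induction n)
  case (Suc n)
  have "ln (real (Suc n)) \<le> real n"
    using ln_add_one_self_le_self[of "real n"] by (simp add: add.commute)
  with Suc show ?case unfolding ln_fact_Suc by (simp add: power2_eq_square algebra_simps)
qed simp

text \<open>The test functions built from \<open>trunc\<close> give the bound for each
  \<open>N\<close>. The value of \<open>C\<close> is the same for all \<open>N\<close>, because the
  truncations lie below the full functions at time 0 and the generator bound is uniform.\<close>

lemma sum_ln_fact_le_S_Q:
  assumes rates: "0 < lam_f" "0 < lam_b" and T: "0 < T" and cad: "cadlag T \<phi>"
    and sm: "summable (\<lambda>z. pmf (\<phi> 0) z * (ln (fact z) / 2 + T * real z))"
  obtains C where "\<And>N. ereal ((\<Sum>z\<le>N. pmf (\<phi> T) z * (ln (fact z) / 2)) - C)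
    \<le> S_Q lam_f lam_b T \<phi> (\<phi> 0)"
proof
  fix N
  define a :: "nat \<Rightarrow> real" where "a z = ln (fact z) / 2" for z
  define D where "D = lam_b * (exp (1 + T) - 1) + 1 + (lam_f * exp T)\<^sup>2"
  \<comment> \<open>\<open>trunc N real\<close> vanishes from \<open>N + N\<close> on,
    \<open>trunc N a\<close> from \<open>N + nat \<lceil>a N\<rceil>\<close> on; \<open>K\<close>
    exceeds neither bound from below.\<close>
  define K where "K = N + (N + nat \<lceil>a N\<rceil>)"
  define A where "A = trunc N a"
  define B where "B = trunc N real"
  have a: "mono a" "\<And>z. 0 \<le> a z" and r: "mono real"
    using mono_ln_fact by (auto simp: a_def mono_def ln_fact_nonneg divide_right_mono)
  have A: "A z = 0" "B z = 0" if "K \<le> z" for z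
    using that a unfolding A_def B_def by (auto intro!: trunc_eq_0 simp: K_def)
  have "0 \<le> D" using rates T by (simp add: D_def)
  have "(\<Sum>z\<le>N. pmf (\<phi> T) z * a z) = (\<Sum>z\<le>N. pmf (\<phi> T) z * A z)"
    by (intro sum.cong) (auto simp: A_def trunc_def)
  also have "\<dots> \<le> (\<Sum>z\<le>K. pmf (\<phi> T) z * A z)"
    using a by (intro sum_mono2) (auto simp: K_def A_def intro!: mult_nonneg_nonneg trunc_nonneg)
  also have "\<dots> = pairing (\<phi> T) A"
    using A by (intro pairing_eq_sum[symmetric]) auto
  finally have final: "(\<Sum>z\<le>N. pmf (\<phi> T) z * a z) \<le> pairing (\<phi> T) A" .
  have "pairing (\<phi> 0) (\<lambda>z. A z + T * B z) = (\<Sum>z\<le>K. pmf (\<phi> 0) z * (A z + T * B z))"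
    using A by (intro pairing_eq_sum) auto
  also have "\<dots> \<le> (\<Sum>z\<le>K. pmf (\<phi> 0) z * (a z + T * real z))"
    using T a r by (intro sum_mono mult_left_mono add_mono) (auto simp: A_def B_def intro!: trunc_le)
  also have "\<dots> \<le> (\<Sum>z. pmf (\<phi> 0) z * (a z + T * real z))"
    using sm T a by (intro sum_le_suminf) (auto simp: a_def)
  finally have initial: "pairing (\<phi> 0) (\<lambda>z. A z + T * B z) \<le> (\<Sum>z. pmf (\<phi> 0) z * (a z + T * real z))" .
  have "ereal (pairing (\<phi> T) A - pairing (\<phi> 0) (\<lambda>z. A z + T * B z) - T * D)
      \<le> S_Q lam_f lam_b T \<phi> (\<phi> 0)"
  proof (rule S_Q_ge_affine_test[OF T cad, where K = K])
    fix u z assume "0 \<le> u" "u \<le> T"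
    then show "exp_gen lam_f lam_b (\<lambda>z. A z + (T - u) * B z) z - B z \<le> D"
      unfolding A_def B_def D_def a_def[abs_def] using rates by (intro exp_gen_trunc_le) auto
  qed (use A \<open>0 \<le> D\<close> in auto)
  \<comment> \<open>This fixes the witness \<open>C\<close>: the initial mean plus
    \<open>T * D\<close>. Both are written out, since \<open>a\<close> and \<open>D\<close> were
    introduced after \<open>N\<close>.\<close>
  then show "ereal ((\<Sum>z\<le>N. pmf (\<phi> T) z * (ln (fact z) / 2)) -
      ((\<Sum>z. pmf (\<phi> 0) z * (ln (fact z) / 2 + T * real z)) +
        T * (lam_b * (exp (1 + T) - 1) + 1 + (lam_f * exp T)\<^sup>2))) \<le> S_Q lam_f lam_b T \<phi> (\<phi> 0)"
    using final initial unfolding a_def D_def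
    by (elim order_trans[rotated]) simp
qed

text \<open>Finite action would make \<open>ln (fact z)\<close> summable against the final measure;
  adding the finite mean, \<open>mult_ln_le_ln_fact\<close> would make \<open>z ln z\<close>
  summable too.\<close>

lemma S_Q_eq_infinity:
  assumes rates: "0 < lam_f" "0 < lam_b" and T: "0 < T" and cad: "cadlag T \<phi>"
    and sm: "summable (\<lambda>z. pmf (\<phi> 0) z * (real z)\<^sup>2)"
    and mean: "summable (\<lambda>z. real z * pmf (\<phi> T) z)"
    and inf: "(\<Sum>z. ennreal (real z * ln (real z) * pmf (\<phi> T) z)) = \<infinity>"
  shows "S_Q lam_f lam_b T \<phi> (\<phi> 0) = \<infinity>"
proof (rule ccontr)
  have "summable (\<lambda>z. pmf (\<phi> 0) z * (ln (fact z) / 2 + T * real z))"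
  proof (rule summable_comparison_test'[where N = 0])
    show "summable (\<lambda>z. (1 + T) * (pmf (\<phi> 0) z * (real z)\<^sup>2))"
      using sm by (rule summable_mult)
    fix z
    have "real z \<le> (real z)\<^sup>2"
      by (cases z) (auto simp: power2_eq_square)
    then have "T * real z \<le> T * (real z)\<^sup>2" using T by simp
    moreover have "0 \<le> T * real z" using T by simp
    ultimately have "0 \<le> ln (fact z) / 2 + T * real z" "ln (fact z) / 2 + T * real z \<le> (1 + T) * (real z)\<^sup>2"
      using ln_fact_le_square[of z] ln_fact_nonneg[of z] unfolding distrib_right by linarith+
    then have "pmf (\<phi> 0) z * (ln (fact z) / 2 + T * real z) \<le> pmf (\<phi> 0) z * ((1 + T) * (real z)\<^sup>2)"
      "0 \<le> pmf (\<phi> 0) z * (ln (fact z) / 2 + T * real z)"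
      by (auto intro!: mult_left_mono mult_nonneg_nonneg simp del: distrib_left)
    then show "norm (pmf (\<phi> 0) z * (ln (fact z) / 2 + T * real z)) \<le> (1 + T) * (pmf (\<phi> 0) z * (real z)\<^sup>2)"
      by (simp add: mult_ac)
  qed
  from sum_ln_fact_le_S_Q[OF rates T cad this] obtain C where
    C: "\<And>N. ereal ((\<Sum>z\<le>N. pmf (\<phi> T) z * (ln (fact z) / 2)) - C) \<le> S_Q lam_f lam_b T \<phi> (\<phi> 0)"
    by blast
  assume "S_Q lam_f lam_b T \<phi> (\<phi> 0) \<noteq> \<infinity>"
  \<comment> \<open>The bound for \<open>N = 0\<close> excludes the value minus infinity.\<close>
  with C[of 0] obtain M where M: "S_Q lam_f lam_b T \<phi> (\<phi> 0) = ereal M"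
    by (cases "S_Q lam_f lam_b T \<phi> (\<phi> 0)") auto
  have "(\<Sum>z\<le>N. norm (pmf (\<phi> T) z * (ln (fact z) / 2))) \<le> M + C" for N
    using C[of N] by (simp add: M ln_fact_nonneg)
  then have "summable (\<lambda>z. norm (pmf (\<phi> T) z * (ln (fact z) / 2)))"
    by (intro bounded_imp_summable) auto
  then have "summable (\<lambda>z. pmf (\<phi> T) z * (ln (fact z) / 2))"
    by (rule summable_norm_cancel)
  from summable_add[OF summable_mult[OF this, of 2] mean]
  have "summable (\<lambda>z. real z * ln (real z) * pmf (\<phi> T) z)"
  proof (rule summable_comparison_test'[where N = 0])
    fix z
    have "0 \<le> real z * ln (real z)" by (cases z) auto
    with mult_right_mono[OF mult_ln_le_ln_fact[of z], of "pmf (\<phi> T) z"]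
    show "norm (real z * ln (real z) * pmf (\<phi> T) z) \<le> 2 * (pmf (\<phi> T) z * (ln (fact z) / 2)) + real z * pmf (\<phi> T) z"
      by (subst real_norm_def, subst abs_of_nonneg[OF mult_nonneg_nonneg]) (auto simp: algebra_simps)
  qed
  then have "(\<Sum>z. ennreal (real z * ln (real z) * pmf (\<phi> T) z)) \<noteq> top"
  proof (rule ennreal_suminf_neq_top)
    show "0 \<le> real z * ln (real z) * pmf (\<phi> T) z" for z by (cases z) auto
  qed
  with inf show False by simp
qed

section \<open>Finite entropy relative to the geometric measure\<close>

text \<open>Differentiating the geometric series twice gives the coefficients
  \<open>(n + 1) (n + 2)\<close>, which dominate \<open>n^2\<close>.\<close>

lemma summable_square_geometric:
  fixes r :: real
  assumes "0 < r" "r < 1"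
  shows "summable (\<lambda>n. (real n)\<^sup>2 * r ^ n)"
proof -
  have 1: "summable (\<lambda>n. diffs (\<lambda>_. 1 :: real) n * x ^ n)" if "norm x < 1" for x
    using that by (rule termdiff_converges) (simp add: summable_geometric)
  have "summable (\<lambda>n. diffs (diffs (\<lambda>_. 1 :: real)) n * r ^ n)"
    by (rule termdiff_converges[of r 1]) (use assms 1 in auto)
  then show ?thesis
    by (rule summable_comparison_test'[where N = 0])
      (use assms in \<open>auto simp: diffs_def power2_eq_square algebra_simps\<close>)
qed

text \<open>Since \<open>ln (pmf \<xi> z) \<le> 0\<close>, each entropy term is at most
  \<open>- pmf \<xi> z * ln (pmf \<nu> z)\<close>, and \<open>ln (pmf \<nu> z)\<close> is affine in
  \<open>z\<close>.\<close>

lemma rel_entropy_geometric_less_infinity: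
  assumes r: "0 < r" "r < 1" and \<nu>: "\<And>z. pmf \<nu> z = (1 - r) * r ^ z"
    and mean: "summable (\<lambda>z. real z * pmf \<xi> z)"
  shows "rel_entropy \<xi> \<nu> < \<infinity>"
proof -
  \<comment> \<open>With full support, the empty set is the only null set.\<close>
  have "set_pmf \<nu> = UNIV" using r by (auto simp: set_pmf_eq \<nu>)
  then have "A = {}" if "A \<in> null_sets (measure_pmf \<nu>)" for A
    using that measure_pmf_zero_iff[of \<nu> A] by (auto simp: null_sets_def measure_def)
  then have ac: "absolutely_continuous (measure_pmf \<nu>) (measure_pmf \<xi>)"
    by (auto simp: absolutely_continuous_def)
  define h where "h z = pmf \<xi> z * (- ln (1 - r) - real z * ln r)" for z
  have le: "pmf \<xi> z * ln (pmf \<xi> z / pmf \<nu> z) \<le> h z" for z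
  proof (cases "pmf \<xi> z = 0")
    case False
    then have pos: "0 < pmf \<xi> z" by (simp add: pmf_pos)
    have "ln (pmf \<nu> z) = ln (1 - r) + real z * ln r"
      using r by (simp add: \<nu> ln_mult ln_realpow)
    moreover have "ln (pmf \<xi> z / pmf \<nu> z) = ln (pmf \<xi> z) - ln (pmf \<nu> z)"
      using pos r by (intro ln_divide_pos) (auto simp: \<nu>)
    moreover have "ln (pmf \<xi> z) \<le> 0" using pos by (simp add: pmf_le_1)
    ultimately show ?thesis unfolding h_def by (intro mult_left_mono) auto
  qed (simp add: h_def)
  have "summable (\<lambda>z. - ln (1 - r) * pmf \<xi> z - ln r * (real z * pmf \<xi> z))"
  proof (intro summable_diff summable_mult mean)
    have "(\<Sum>z. ennreal (pmf \<xi> z)) = 1"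
      using nn_integral_pmf[of UNIV \<xi>] by (simp add: nn_integral_count_space_nat)
    then show "summable (pmf \<xi>)" by (intro summable_suminf_not_top) auto
  qed
  also have "(\<lambda>z. - ln (1 - r) * pmf \<xi> z - ln r * (real z * pmf \<xi> z)) = h"
    by (auto simp: h_def algebra_simps)
  finally have "(\<Sum>z. ennreal (h z)) \<noteq> top"
  proof (rule ennreal_suminf_neq_top)
    have "ln r \<le> 0" "ln (1 - r) \<le> 0" using r by auto
    then have "0 \<le> - ln (1 - r) - real z * ln r" for z
      using mult_nonneg_nonpos[of "real z" "ln r"] by simp
    then show "0 \<le> h z" for z
      unfolding h_def by (intro mult_nonneg_nonneg) auto
  qed
  moreover have "(\<Sum>z. ennreal (pmf \<xi> z * ln (pmf \<xi> z / pmf \<nu> z))) \<le> (\<Sum>z. ennreal (h z))"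
    by (intro suminf_le ennreal_leI le) auto
  ultimately have "(\<Sum>z. ennreal (pmf \<xi> z * ln (pmf \<xi> z / pmf \<nu> z))) \<noteq> top"
    by (metis neq_top_trans)
  then obtain x where "(\<Sum>z. ennreal (pmf \<xi> z * ln (pmf \<xi> z / pmf \<nu> z))) = ennreal x" "0 \<le> x"
    by (metis ennreal_cases)
  \<comment> \<open>The negative part is subtracted, so a lower bound on it suffices for an upper
    bound on the entropy.\<close>
  moreover have "0 \<le> enn2ereal (\<Sum>z. ennreal (- (pmf \<xi> z * ln (pmf \<xi> z / pmf \<nu> z))))"
    by simp
  ultimately show ?thesis
    using ac by (cases "enn2ereal (\<Sum>z. ennreal (- (pmf \<xi> z * ln (pmf \<xi> z / pmf \<nu> z))))")
      (auto simp: rel_entropy_def ext_sum_def enn2ereal_ennreal)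
qed

section \<open>A measure with finite mean and infinite mean of z ln z\<close>

text \<open>At \<open>2^k\<close> the factor \<open>z\<close> cancels the power of 2 in the weight,
  leaving the convergent series of \<open>1 / (k + 1)^2\<close> for the mean. The extra factor
  \<open>ln (2^k) = k ln 2\<close> makes the other series diverge.\<close>

lemma ex_pmf_finite_mean_infinite_nlogn:
  "\<exists>\<xi> :: nat pmf. (\<Sum>z. ennreal (real z * pmf \<xi> z)) < \<infinity> \<and>
     (\<Sum>z. ennreal (real z * ln (real z) * pmf \<xi> z)) = \<infinity>"
proof -
  define w :: "nat \<Rightarrow> real" where "w k = 1 / (2 ^ k * (real (Suc k))\<^sup>2)" for k
  have w: "0 < w k" for k by (simp add: w_def)
  have sq: "summable (\<lambda>k. 1 / (real (Suc k))\<^sup>2)"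
    using inverse_power_summable[of 2, where ?'a = real] summable_Suc_iff[of "\<lambda>n. inverse (real n ^ 2)"]
    by (simp add: inverse_eq_divide)
  have sw: "summable w"
  proof (rule summable_comparison_test'[OF sq, where N = 0])
    show "norm (w k) \<le> 1 / (real (Suc k))\<^sup>2" for k
      unfolding w_def by (simp add: field_simps del: of_nat_Suc)
  qed
  have pos: "0 < suminf w" using sw w by (intro suminf_pos) auto
  define c where "c = 1 / suminf w"
  have "0 < c" using pos by (simp add: c_def)
  define q where "q = embed_pmf (\<lambda>k. c * w k)"
  have q: "pmf q k = c * w k" for k
    unfolding q_def
  proof (rule pmf_embed_pmf)
    show "0 \<le> c * w k" for k using w[of k] \<open>0 < c\<close> by simp
    have "(\<lambda>k. c * w k) sums (c * suminf w)"
      using sw by (intro sums_mult) (simp add: summable_sums)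
    then have "(\<Sum>k. ennreal (c * w k)) = ennreal (c * suminf w)"
      using w \<open>0 < c\<close> by (intro suminf_ennreal_eq) (auto intro: less_imp_le)
    then show "(\<integral>\<^sup>+ k. ennreal (c * w k) \<partial>count_space UNIV) = 1"
      using pos by (simp add: nn_integral_count_space_nat c_def)
  qed
  define \<xi> where "\<xi> = map_pmf (\<lambda>k. 2 ^ k :: nat) q"
  \<comment> \<open>Change of variables along \<open>map_pmf\<close>: sums over the sparse support
    become sums over the exponent.\<close>
  have eq: "(\<Sum>z. ennreal (h z * pmf \<xi> z)) = (\<Sum>k. ennreal (c * (h (2 ^ k) * w k)))"
    if "\<And>z. 0 \<le> h z" for h :: "nat \<Rightarrow> real"
  proof -
    have "(\<Sum>z. ennreal (h z * pmf \<xi> z)) = (\<integral>\<^sup>+ z. ennreal (h z) \<partial>measure_pmf \<xi>)"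
      unfolding nn_integral_measure_pmf nn_integral_count_space_nat
      using that by (intro suminf_cong) (subst mult.commute, simp add: ennreal_mult'')
    also have "\<dots> = (\<integral>\<^sup>+ k. ennreal (h (2 ^ k)) \<partial>measure_pmf q)"
      by (simp add: \<xi>_def)
    also have "\<dots> = (\<Sum>k. ennreal (c * (h (2 ^ k) * w k)))"
      unfolding nn_integral_measure_pmf nn_integral_count_space_nat
    proof (intro suminf_cong)
      fix k
      have "ennreal (pmf q k) * ennreal (h (2 ^ k)) = ennreal (pmf q k * h (2 ^ k))"
        using that by (subst ennreal_mult'') auto
      then show "ennreal (pmf q k) * ennreal (h (2 ^ k)) = ennreal (c * (h (2 ^ k) * w k))"
        by (simp only: q mult_ac)
    qed
    finally show ?thesis .
  qed
  have "summable (\<lambda>k. c * (real (2 ^ k) * w k))"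
    using sq by (intro summable_mult) (simp add: w_def)
  then have "(\<Sum>k. ennreal (c * (real (2 ^ k) * w k))) \<noteq> top"
    using \<open>0 < c\<close> w[THEN less_imp_le] by (intro ennreal_suminf_neq_top mult_nonneg_nonneg) auto
  then have fin: "(\<Sum>z. ennreal (real z * pmf \<xi> z)) < \<infinity>"
    by (subst eq) (auto simp: less_top)
  have nn: "0 \<le> real z * ln (real z)" for z :: nat by (cases z) auto
  have "(\<Sum>k. ennreal (c * (real (2 ^ k) * ln (real (2 ^ k)) * w k))) = top"
  proof (rule ccontr)
    assume "(\<Sum>k. ennreal (c * (real (2 ^ k) * ln (real (2 ^ k)) * w k))) \<noteq> top"
    then have "summable (\<lambda>k. c * (real (2 ^ k) * ln (real (2 ^ k)) * w k))"
      using \<open>0 < c\<close> w[THEN less_imp_le] nn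
      by (intro summable_suminf_not_top mult_nonneg_nonneg[of c] mult_nonneg_nonneg[OF nn]) auto
    also have "(\<lambda>k. c * (real (2 ^ k) * ln (real (2 ^ k)) * w k)) =
        (\<lambda>k. (c * ln 2) * (real k / (real (Suc k))\<^sup>2))"
      by (auto simp: w_def ln_realpow)
    finally have "summable (\<lambda>k. real k / (real (Suc k))\<^sup>2)"
      using \<open>0 < c\<close> by (subst (asm) summable_cmult_iff) auto
    \<comment> \<open>Adding \<open>1 / (k + 1)^2\<close> turns \<open>k / (k + 1)^2\<close> into
      exactly \<open>1 / (k + 1)\<close>, the harmonic series.\<close>
    from summable_add[OF this sq]
    have "summable (\<lambda>k. real k / (real (Suc k))\<^sup>2 + 1 / (real (Suc k))\<^sup>2)" .
    also have "(\<lambda>k. real k / (real (Suc k))\<^sup>2 + 1 / (real (Suc k))\<^sup>2) = (\<lambda>k. inverse (real (Suc k)))"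
    proof
      fix k
      have "real k / (real (Suc k))\<^sup>2 + 1 / (real (Suc k))\<^sup>2 = real (Suc k) / (real (Suc k))\<^sup>2"
        unfolding add_divide_distrib[symmetric] by simp
      then show "real k / (real (Suc k))\<^sup>2 + 1 / (real (Suc k))\<^sup>2 = inverse (real (Suc k))"
        by (simp add: power2_eq_square inverse_eq_divide del: of_nat_Suc)
    qed
    finally have "summable (\<lambda>n. inverse (real n))"
      by (subst (asm) summable_Suc_iff)
    then show False using not_summable_harmonic[where ?'a = real] by simp
  qed
  then have "(\<Sum>z. ennreal (real z * ln (real z) * pmf \<xi> z)) = \<infinity>"
    unfolding infinity_ennreal_def by (subst eq) (rule nn)
  with fin show ?thesis by blast
qed

section \<open>Infinite quasipotential against finite relative entropy\<close>

theorem proposition8p1: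
  fixes lam_f lam_b :: real and \<xi>Q :: "nat pmf"
  assumes "0 < lam_f" and "lam_f < lam_b"
    and "\<And>z. pmf \<xi>Q z = (1 - lam_f / lam_b) * (lam_f / lam_b) ^ z"
  shows "(\<forall>\<xi> :: nat pmf.
            (\<Sum>z. ennreal (real z * pmf \<xi> z)) < \<infinity> \<longrightarrow>
            (\<Sum>z. ennreal (real z * ln (real z) * pmf \<xi> z)) = \<infinity> \<longrightarrow>
            rel_entropy \<xi> \<xi>Q < \<infinity> \<and> V_Q lam_f lam_b \<xi>Q \<xi> = \<infinity>)
       \<and> V_Q lam_f lam_b \<xi>Q \<noteq> (\<lambda>\<xi>. rel_entropy \<xi> \<xi>Q)"
proof -
  define r where "r = lam_f / lam_b"
  have r: "0 < r" "r < 1" using assms by (auto simp: r_def)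
  have \<xi>Q: "pmf \<xi>Q z = (1 - r) * r ^ z" for z using assms by (simp add: r_def)
  have sm: "summable (\<lambda>z. pmf \<xi>Q z * (real z)\<^sup>2)"
    using summable_mult[OF summable_square_geometric[OF r], of "1 - r"] by (simp add: \<xi>Q mult_ac)
  have main: "rel_entropy \<xi> \<xi>Q < \<infinity> \<and> V_Q lam_f lam_b \<xi>Q \<xi> = \<infinity>"
    if fin: "(\<Sum>z. ennreal (real z * pmf \<xi> z)) < \<infinity>"
      and inf: "(\<Sum>z. ennreal (real z * ln (real z) * pmf \<xi> z)) = \<infinity>" for \<xi>
  proof
    have mean: "summable (\<lambda>z. real z * pmf \<xi> z)"
      using fin by (intro summable_suminf_not_top) auto
    then show "rel_entropy \<xi> \<xi>Q < \<infinity>"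
      using r \<xi>Q by (rule rel_entropy_geometric_less_infinity[rotated 3])
    have "S_Q lam_f lam_b T \<phi> \<xi>Q = \<infinity>"
      if "0 < T" "cadlag T \<phi>" "\<phi> 0 = \<xi>Q" "\<phi> T = \<xi>" for T \<phi>
      using S_Q_eq_infinity[of lam_f lam_b T \<phi>] that assms sm mean inf by simp
    then show "V_Q lam_f lam_b \<xi>Q \<xi> = \<infinity>"
      unfolding V_Q_def by (intro antisym Inf_greatest) auto
  qed
  moreover have "V_Q lam_f lam_b \<xi>Q \<noteq> (\<lambda>\<xi>. rel_entropy \<xi> \<xi>Q)"
  proof
    assume eq: "V_Q lam_f lam_b \<xi>Q = (\<lambda>\<xi>. rel_entropy \<xi> \<xi>Q)"
    from ex_pmf_finite_mean_infinite_nlogn obtain \<xi> where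
      "(\<Sum>z. ennreal (real z * pmf \<xi> z)) < \<infinity>" "(\<Sum>z. ennreal (real z * ln (real z) * pmf \<xi> z)) = \<infinity>"
      by blast
    from main[OF this] show False using fun_cong[OF eq, of \<xi>] by simp
  qed
  ultimately show ?thesis by blast
qed

end
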